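(* There exists a strictly increasing sequence $(\lambda_m)_{m=1}^{\infty}$ of real numbers converging to $\frac{1+\sqrt5}{2}$ such that, for every $m\in\mathbb{N}$ and every $\beta\in(1,\lambda_m]$, $$\dim_H(\Sigma_\beta(x))\geq\frac{1}{m+2}\quad\text{for any } x\in\Big(0,\frac{1}{\beta-1}\Big).$$
   Context: For $1<\beta<2$ and $x\in[0,\frac{1}{\beta-1}]$, let $\Sigma_\beta(x)=\{(\epsilon_n)_{n=1}^{\infty}\in\{0,1\}^{\mathbb{N}}:\sum_{n=1}^{\infty}\epsilon_n\beta^{-n}=x\}$ be the set of $\beta$-expansions of $x$. Here $\mathbb{N}=\{1,2,3,\ldots\}$. The space $\{0,1\}^{\mathbb{N}}$ carries the metric $d(x,y)=2^{-n(x,y)}$ if $x\neq y$, where $n(x,y)=\inf\{i\ge 1:x_i\neq y_i\}$, and $d(x,x)=0$. $\dim_H$ denotes Hausdorff dimension with respect to this metric. *)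

theory Defs
  imports "HOL-Analysis.Analysis"
begin

context Metric_space
begin

definition hdiam :: "'a set \<Rightarrow> ennreal" where
  "hdiam U = (SUP x\<in>U. SUP y\<in>U. ennreal (d x y))"

text \<open>
  The term \<open>(diam U)\<^sup>s\<close> with the usual conventions: the empty set contributes \<open>0\<close>, and
  \<open>0\<^sup>0 = 1\<close> for nonempty \<open>U\<close> (whereas \<open>0 powr 0 = 0\<close>). It is only used for sets of finite
  diameter, where \<open>enn2real\<close> loses nothing.
\<close>
definition hgauge :: "real \<Rightarrow> 'a set \<Rightarrow> ennreal" where
  "hgauge s U =
     (if U = {} then 0 else if s = 0 then 1 else ennreal (enn2real (hdiam U) powr s))"

definition hausdorff_premeasure :: "real \<Rightarrow> real \<Rightarrow> 'a set \<Rightarrow> ennreal" where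
  "hausdorff_premeasure s \<delta> A =
     (INF U\<in>{U :: nat \<Rightarrow> 'a set.
               (\<forall>i. U i \<subseteq> M \<and> hdiam (U i) \<le> ennreal \<delta>) \<and> A \<subseteq> (\<Union>i. U i)}.
        (\<Sum>i. hgauge s (U i)))"

definition hausdorff_measure :: "real \<Rightarrow> 'a set \<Rightarrow> ennreal" where
  "hausdorff_measure s A = (SUP \<delta>\<in>{0<..}. hausdorff_premeasure s \<delta> A)"

text \<open>The value is \<open>\<infinity>\<close> if no \<open>s\<close> qualifies, and \<open>0\<close> for the empty set.\<close>
definition hausdorff_dim :: "'a set \<Rightarrow> ennreal" where
  "hausdorff_dim A = (INF s\<in>{s. 0 \<le> s \<and> hausdorff_measure s A = 0}. ennreal s)"

end

text \<open>
  The space \<open>{0,1}\<^sup>\<nat>\<close> with \<open>\<nat> = {1,2,3,\<dots>}\<close>. Being extensional functions on \<open>{1..}\<close>, its elements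
  carry no information at index \<open>0\<close>.
\<close>
definition digit_seqs :: "(nat \<Rightarrow> nat) set" where
  "digit_seqs = {1..} \<rightarrow>\<^sub>E {0, 1}"

definition first_diff :: "(nat \<Rightarrow> nat) \<Rightarrow> (nat \<Rightarrow> nat) \<Rightarrow> nat" where
  "first_diff x y = (LEAST i. 1 \<le> i \<and> x i \<noteq> y i)"

definition seq_dist :: "(nat \<Rightarrow> nat) \<Rightarrow> (nat \<Rightarrow> nat) \<Rightarrow> real" where
  "seq_dist x y = (if x = y then 0 else (1 / 2) ^ first_diff x y)"

lemma digit_seqs_differ:
  assumes "x \<in> digit_seqs" "y \<in> digit_seqs" "x \<noteq> y"
  shows "\<exists>i\<ge>1. x i \<noteq> y i"
proof (rule ccontr)
  assume "\<not> ?thesis"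
  then have "x = y"
    using assms(1,2) unfolding digit_seqs_def by (intro PiE_ext) auto
  with assms(3) show False by simp
qed

interpretation digit_seqs: Metric_space digit_seqs seq_dist
proof
  show "0 \<le> seq_dist x y" for x y
    by (simp add: seq_dist_def)
  show "seq_dist x y = seq_dist y x" for x y
    by (simp add: seq_dist_def first_diff_def eq_commute)
  show "seq_dist x y = 0 \<longleftrightarrow> x = y" for x y
    by (simp add: seq_dist_def)
  fix x y z
  assume mem: "x \<in> digit_seqs" "y \<in> digit_seqs" "z \<in> digit_seqs"
  show "seq_dist x z \<le> seq_dist x y + seq_dist y z"
  proof (cases "x = y \<or> y = z \<or> x = z")
    case True
    then show ?thesis by (auto simp: seq_dist_def)
  next
    case False
    let ?k = "first_diff x z"
    have k: "1 \<le> ?k \<and> x ?k \<noteq> z ?k"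
      unfolding first_diff_def using digit_seqs_differ[of x z] mem False
      by (metis (mono_tags, lifting) LeastI)
    then have "x ?k \<noteq> y ?k \<or> y ?k \<noteq> z ?k" by auto
    then have "first_diff x y \<le> ?k \<or> first_diff y z \<le> ?k"
      using k by (metis (mono_tags, lifting) Least_le first_diff_def)
    then have "(1 / 2 :: real) ^ ?k \<le> (1 / 2) ^ first_diff x y
        \<or> (1 / 2 :: real) ^ ?k \<le> (1 / 2) ^ first_diff y z"
      by (auto intro: power_decreasing)
    moreover have "0 \<le> (1 / 2 :: real) ^ first_diff x y" "0 \<le> (1 / 2 :: real) ^ first_diff y z"
      by simp_all
    ultimately have "(1 / 2 :: real) ^ ?k \<le> (1 / 2) ^ first_diff x y + (1 / 2) ^ first_diff y z"
      by linarith
    then show ?thesis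
      using False by (simp only: seq_dist_def de_Morgan_disj if_False simp_thms)
  qed
qed

definition beta_expansions :: "real \<Rightarrow> real \<Rightarrow> (nat \<Rightarrow> nat) set" where
  "beta_expansions \<beta> x =
     {\<epsilon> \<in> digit_seqs. (\<lambda>n. real (\<epsilon> (Suc n)) / \<beta> ^ Suc n) sums x}"

end

theory Submission
  imports Defs
begin

text \<open>
  The \<open>\<beta>\<close>-expansions of \<open>x\<close> are the digit sequences of the orbits of \<open>x\<close> under free choices
  between \<open>x \<mapsto> \<beta> x\<close> (digit \<open>0\<close>) and \<open>x \<mapsto> \<beta> x - 1\<close> (digit \<open>1\<close>), as long as the orbit stays
  in \<open>[0, 1/(\<beta>-1)]\<close>. For \<open>\<beta>\<close> below the golden ratio put \<open>p = 1/(\<beta>\<^sup>2-1)\<close> and call \<open>[p, \<beta> p]\<close> the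
  switch interval. It is symmetric in \<open>[0, 1/(\<beta>-1)]\<close>, and in it both choices are allowed: they
  lead to points at distance at least \<open>\<beta> p - 1 > 0\<close> from the two ends \<open>0\<close> and \<open>1/(\<beta>-1)\<close>. To the
  left of \<open>p\<close> multiplication by \<open>\<beta>\<close> moves the orbit to the right and cannot jump over the switch
  interval, because that interval has ratio \<open>\<beta>\<close>; the right-hand side is its mirror image. So after
  a choice the orbit is back in the switch interval in at most \<open>k\<close> steps as soon as
  \<open>\<beta>\<^sup>k (\<beta> p - 1) \<ge> p\<close>, that is \<open>\<beta>\<^sup>k (1 + \<beta> - \<beta>\<^sup>2) \<ge> 1\<close>.

  Hence one free binary choice occurs in every \<open>k + 1\<close> digits. Reading these choices off the binary
  expansion of a number \<open>t \<in> [0,1)\<close> gives a map from \<open>[0,1)\<close> into the expansions of \<open>x\<close>. Two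
  expansions that agree in \<open>n\<close> digits come from numbers that agree in about \<open>n/(k+1)\<close> bits
  (\<open>common_digits_imp_close\<close>), so the inverse of this map is Hoelder continuous with exponent
  \<open>1/(k+1)\<close>. As \<open>[0,1)\<close> has Lebesgue measure \<open>1\<close>, the dimension is at least \<open>1/(k+1)\<close>
  (\<open>hausdorff_dim_ge_if_inverse_Hoelder\<close>).

  By Bernoulli's inequality the condition on \<open>k\<close> follows from \<open>k (1 + \<beta> - \<beta>\<^sup>2) \<ge> \<beta>\<close>, or
  equivalently \<open>\<beta>\<^sup>2 \<le> (1 - 1/k) \<beta> + 1\<close>. With \<open>k = m + 1\<close>, the positive root of
  \<open>\<lambda>\<^sup>2 = m/(m+1) \<lambda> + 1\<close> is therefore a suitable \<open>\<lambda>\<^sub>m\<close>.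
\<close>

section \<open>A lower bound for the Hausdorff dimension\<close>

context Metric_space
begin

text \<open>
  A cover of \<open>A\<close> pulls back to a cover of \<open>[0,1)\<close>, and the part of \<open>[0,1)\<close> that belongs to a set
  \<open>U\<close> of the cover lies in an interval of length \<open>2 C\<close> times the \<open>s'\<close>-th power of the
  diameter of \<open>U\<close>; these lengths add up to at least \<open>1\<close>. Diameters are at most \<open>1\<close> so that the hypothesis, which has the exponent \<open>s\<close>,
  implies the same estimate with the smaller exponent \<open>s'\<close>.
\<close>

lemma hausdorff_premeasure_pos_if_inverse_Hoelder:
  fixes f :: "real \<Rightarrow> 'a"
  assumes "C > 0" and s': "0 \<le> s'" "s' \<le> s"
    and f: "f ` {0..<1} \<subseteq> A"
    and Hoelder: "\<And>t u. t \<in> {0..<1} \<Longrightarrow> u \<in> {0..<1} \<Longrightarrow> t \<noteq> u \<Longrightarrow>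
                    \<bar>t - u\<bar> \<le> C * d (f t) (f u) powr s"
  shows "ennreal (1 / (2 * C)) \<le> hausdorff_premeasure s' 1 A"
  unfolding hausdorff_premeasure_def
proof (rule INF_greatest)
  fix U :: "nat \<Rightarrow> 'a set"
  assume "U \<in> {U. (\<forall>i. U i \<subseteq> M \<and> hdiam (U i) \<le> ennreal 1) \<and> A \<subseteq> (\<Union>i. U i)}"
  then have diam: "\<And>i. hdiam (U i) \<le> ennreal 1" and cover: "A \<subseteq> (\<Union>i. U i)"
    by auto
  define T where "T i = {t \<in> {0..<1}. f t \<in> U i}" for i
  define c where "c i = (SOME t. t \<in> T i)" for i
  define r where "r i = C * enn2real (hgauge s' (U i))" for i
  have hgauge_finite: "hgauge s' (U i) = ennreal (enn2real (hgauge s' (U i)))" for i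
    by (auto simp: hgauge_def)
  have dist_le: "\<bar>t - u\<bar> \<le> r i" if tu: "t \<in> T i" "u \<in> T i" for t u i
  proof (cases "t = u")
    case True
    then show ?thesis using \<open>C > 0\<close> by (simp add: r_def)
  next
    case False
    have "t \<in> {0..<1}" "u \<in> {0..<1}" and fU: "f t \<in> U i" "f u \<in> U i"
      using tu by (auto simp: T_def)
    then have H: "\<bar>t - u\<bar> \<le> C * d (f t) (f u) powr s"
      using Hoelder False by blast
    have "ennreal (d (f t) (f u)) \<le> hdiam (U i)"
      unfolding hdiam_def using fU by (meson SUP_upper2 order_refl)
    moreover have "hdiam (U i) < top"
      using diam[of i] by (rule le_less_trans) simp
    ultimately have d_le: "d (f t) (f u) \<le> enn2real (hdiam (U i))"
      using enn2real_mono[of "ennreal (d (f t) (f u))" "hdiam (U i)"] by simp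
    have "ennreal (d (f t) (f u)) \<le> ennreal 1"
      using \<open>ennreal (d (f t) (f u)) \<le> hdiam (U i)\<close> diam[of i] by (rule order_trans)
    then have d_le1: "d (f t) (f u) \<le> 1"
      by (subst (asm) ennreal_le_iff) simp_all
    have "0 < d (f t) (f u)"
    proof (rule ccontr)
      assume "\<not> ?thesis"
      then have "d (f t) (f u) = 0" using nonneg[of "f t" "f u"] by linarith
      then show False using H False by simp
    qed
    then have "d (f t) (f u) powr s \<le> enn2real (hgauge s' (U i))"
    proof (cases "s' = 0")
      case True
      then show ?thesis
        using fU s' d_le1
        by (auto simp: hgauge_def intro!: powr_le1)
    next
      case False
      have "d (f t) (f u) powr s \<le> d (f t) (f u) powr s'"
        using s' d_le1 \<open>0 < d (f t) (f u)\<close> by (intro powr_mono') auto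
      also have "\<dots> \<le> enn2real (hdiam (U i)) powr s'"
        using s' d_le nonneg by (intro powr_mono2) auto
      finally show ?thesis
        using False fU by (auto simp: hgauge_def)
    qed
    then show ?thesis
      using H \<open>C > 0\<close> unfolding r_def by (meson mult_left_mono less_imp_le order_trans)
  qed
  have "{0..<1} \<subseteq> (\<Union>i. {c i - r i..c i + r i})"
  proof
    fix t :: real assume t: "t \<in> {0..<1}"
    then obtain i where "t \<in> T i"
      using f cover by (fastforce simp: T_def)
    moreover from this have "c i \<in> T i"
      unfolding c_def by (rule someI)
    ultimately have "\<bar>t - c i\<bar> \<le> r i"
      using dist_le by blast
    then show "t \<in> (\<Union>i. {c i - r i..c i + r i})"
      by (auto simp: abs_le_iff intro!: exI[of _ i])
  qed
  then have "emeasure lborel {0..<1::real} \<le> emeasure lborel (\<Union>i. {c i - r i..c i + r i})"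
    by (intro emeasure_mono) auto
  also have "\<dots> \<le> (\<Sum>i. emeasure lborel {c i - r i..c i + r i})"
    by (intro emeasure_subadditive_countably) auto
  also have "\<dots> = (\<Sum>i. ennreal (2 * C) * hgauge s' (U i))"
  proof (intro suminf_cong)
    fix i
    have "r i \<ge> 0" using \<open>C > 0\<close> by (simp add: r_def)
    then have "emeasure lborel {c i - r i..c i + r i} = ennreal (2 * r i)"
      by simp
    also have "\<dots> = ennreal (2 * C) * hgauge s' (U i)"
      using \<open>C > 0\<close> by (subst hgauge_finite) (simp add: r_def mult.assoc flip: ennreal_mult)
    finally show "emeasure lborel {c i - r i..c i + r i} = ennreal (2 * C) * hgauge s' (U i)" .
  qed
  also have "\<dots> = ennreal (2 * C) * (\<Sum>i. hgauge s' (U i))"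
    by simp
  finally have "1 \<le> ennreal (2 * C) * (\<Sum>i. hgauge s' (U i))"
    by simp
  then have "ennreal (1 / (2 * C)) * 1
      \<le> ennreal (1 / (2 * C)) * (ennreal (2 * C) * (\<Sum>i. hgauge s' (U i)))"
    by (rule mult_left_mono) simp
  also have "\<dots> = (\<Sum>i. hgauge s' (U i))"
    using \<open>C > 0\<close> by (simp add: mult.assoc[symmetric] flip: ennreal_mult)
  finally show "ennreal (1 / (2 * C)) \<le> (\<Sum>i. hgauge s' (U i))"
    by simp
qed

lemma hausdorff_dim_ge_if_inverse_Hoelder:
  fixes f :: "real \<Rightarrow> 'a"
  assumes "C > 0" and f: "f ` {0..<1} \<subseteq> A"
    and "\<And>t u. t \<in> {0..<1} \<Longrightarrow> u \<in> {0..<1} \<Longrightarrow> t \<noteq> u \<Longrightarrow>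
            \<bar>t - u\<bar> \<le> C * d (f t) (f u) powr s"
  shows "ennreal s \<le> hausdorff_dim A"
  unfolding hausdorff_dim_def
proof (rule INF_greatest)
  fix s' assume "s' \<in> {s. 0 \<le> s \<and> hausdorff_measure s A = 0}"
  then have s': "0 \<le> s'" "hausdorff_measure s' A = 0" by auto
  have "hausdorff_premeasure s' 1 A \<le> hausdorff_measure s' A"
    unfolding hausdorff_measure_def by (rule SUP_upper) simp
  moreover have "0 < ennreal (1 / (2 * C))" using \<open>C > 0\<close> by simp
  ultimately have "\<not> s' \<le> s"
    using hausdorff_premeasure_pos_if_inverse_Hoelder[OF \<open>C > 0\<close> s'(1) _ f assms(3)] s'(2)
    by (metis leD le_zero_eq)
  then show "ennreal s \<le> ennreal s'"
    by (simp add: ennreal_leI)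
qed

end

section \<open>Expansions driven by binary choices\<close>

locale below_golden_ratio =
  fixes \<beta> :: real
  assumes gt_1: "1 < \<beta>" and below: "\<beta>\<^sup>2 < \<beta> + 1"
begin

definition p :: real where "p = 1 / (\<beta>\<^sup>2 - 1)"

text \<open>
  A state \<open>(x, t)\<close> consists of the current point \<open>x\<close> of the orbit and of the number \<open>t \<in> [0,1)\<close>
  whose binary expansion contains the choices still to be made. A bit of \<open>t\<close> is consumed only
  when \<open>x\<close> is in the switch interval \<open>[p, \<beta> p]\<close>.
\<close>

definition digit :: "real \<times> real \<Rightarrow> nat" where
  "digit = (\<lambda>(x, t). if x < p then 0 else if \<beta> * p < x then 1 else if t < 1 / 2 then 0 else 1)"

definition step :: "real \<times> real \<Rightarrow> real \<times> real" where
  "step = (\<lambda>(x, t). (\<beta> * x - real (digit (x, t)),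
                      if p \<le> x \<and> x \<le> \<beta> * p then 2 * t - real (digit (x, t)) else t))"

definition digit_seq :: "real \<times> real \<Rightarrow> nat \<Rightarrow> nat" where
  "digit_seq s = (\<lambda>n\<in>{1..}. digit ((step ^^ (n - 1)) s))"

lemma square_gt_1: "1 < \<beta>\<^sup>2"
  using gt_1 by (simp add: one_less_power)

lemma p_eq: "\<beta>\<^sup>2 * p = 1 + p"
  using square_gt_1 by (simp add: p_def field_simps)

lemma p_eq': "\<beta> * (\<beta> * p) = 1 + p"
  using p_eq by (simp add: power2_eq_square algebra_simps)

lemma p_pos: "0 < p"
  using square_gt_1 by (simp add: p_def)

lemma p_le: "p \<le> \<beta> * p"
  using p_pos gt_1 by simp

lemma escape_margin: "\<beta> * p - 1 = (1 + \<beta> - \<beta>\<^sup>2) * p"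
  using p_eq by (simp add: algebra_simps)

text \<open>This is where the golden ratio enters: it puts \<open>p\<close> to the right of
  \<open>1/\<beta>\<close>, the left end of the region in which both digits are possible.\<close>

lemma escape_margin_pos: "0 < \<beta> * p - 1"
  unfolding escape_margin using below p_pos by simp

lemma right_end: "1 / (\<beta> - 1) = p + \<beta> * p"
proof -
  have "(\<beta> - 1) * (p + \<beta> * p) = 1"
    using p_eq by (simp add: algebra_simps power2_eq_square)
  then show ?thesis using gt_1 by (simp add: field_simps)
qed

lemma digit_range: "digit s \<in> {0, 1}"
  by (auto simp: digit_def split: prod.splits)

lemma fst_step: "fst (step s) = \<beta> * fst s - real (digit s)"
  by (simp add: step_def split: prod.splits)

lemma fst_step_range:
  assumes "0 \<le> fst s" "fst s \<le> p + \<beta> * p"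
  shows "0 \<le> fst (step s)" "fst (step s) \<le> p + \<beta> * p"
proof -
  obtain x t where s: "s = (x, t)" by fastforce
  have hi: "\<beta> * x \<le> 1 + (p + \<beta> * p)"
    using mult_left_mono[of x "p + \<beta> * p" \<beta>] assms gt_1 p_eq'
    by (simp add: s algebra_simps)
  have mid: "\<beta> * x \<le> 1 + p" if "x \<le> \<beta> * p"
    using mult_left_mono[OF that, of \<beta>] gt_1 p_eq' by simp
  have lo: "\<beta> * p \<le> \<beta> * x" if "p \<le> x"
    using mult_left_mono[OF that, of \<beta>] gt_1 by simp
  have left: "digit (x, t) = 0 \<Longrightarrow> x \<le> \<beta> * p" and right: "digit (x, t) = 1 \<Longrightarrow> p \<le> x"
    using p_le by (auto simp: digit_def split: if_splits)
  have "0 \<le> \<beta> * x" using assms gt_1 s by simp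
  consider "digit (x, t) = 0" | "digit (x, t) = 1"
    using digit_range[of "(x, t)"] by auto
  then have "0 \<le> fst (step s) \<and> fst (step s) \<le> p + \<beta> * p"
  proof cases
    case 1
    then have "fst (step s) = \<beta> * x" by (simp add: s fst_step)
    then show ?thesis
      using mid[OF left[OF 1]] \<open>0 \<le> \<beta> * x\<close> escape_margin_pos by linarith
  next
    case 2
    then have "fst (step s) = \<beta> * x - 1" by (simp add: s fst_step)
    then show ?thesis
      using lo[OF right[OF 2]] hi escape_margin_pos by linarith
  qed
  then show "0 \<le> fst (step s)" "fst (step s) \<le> p + \<beta> * p"
    by auto
qed

text \<open>Before the orbit enters the switch interval it does not depend on the choices, so this
  predicate on points says that the orbit of \<open>x\<close> first enters it after exactly \<open>r\<close> steps.\<close>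

fun switches_after :: "nat \<Rightarrow> real \<Rightarrow> bool" where
  "switches_after 0 x \<longleftrightarrow> p \<le> x \<and> x \<le> \<beta> * p"
| "switches_after (Suc r) x \<longleftrightarrow>
     x < p \<and> switches_after r (\<beta> * x) \<or> \<beta> * p < x \<and> switches_after r (\<beta> * x - 1)"

text \<open>Since \<open>x < p\<close> gives \<open>\<beta> x < \<beta> p\<close>, the orbit cannot jump over the switch interval.\<close>

lemma switches_from_left:
  assumes "x \<le> \<beta> * p" "p \<le> \<beta> ^ r * x"
  shows "\<exists>r'\<le>r. switches_after r' x"
  using assms
proof (induction r arbitrary: x)
  case 0
  then show ?case by simp
next
  case (Suc r)
  show ?case
  proof (cases "p \<le> x")
    case True
    then show ?thesis using Suc.prems by (intro exI[of _ 0]) simp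
  next
    case False
    then have "\<beta> * x \<le> \<beta> * p" using gt_1 by simp
    moreover have "p \<le> \<beta> ^ r * (\<beta> * x)" using Suc.prems by (simp add: mult_ac)
    ultimately obtain r' where "r' \<le> r" "switches_after r' (\<beta> * x)"
      using Suc.IH by blast
    then show ?thesis using False by (intro exI[of _ "Suc r'"]) simp
  qed
qed

text \<open>The reflection \<open>x \<mapsto> 1/(\<beta>-1) - x\<close> preserves the switch interval and conjugates
  \<open>x \<mapsto> \<beta> x - 1\<close> to \<open>x \<mapsto> \<beta> x\<close>.\<close>

lemma switches_from_right:
  assumes "p \<le> x" "p \<le> \<beta> ^ r * (p + \<beta> * p - x)"
  shows "\<exists>r'\<le>r. switches_after r' x"
  using assms
proof (induction r arbitrary: x)
  case 0
  then show ?case by simp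
next
  case (Suc r)
  show ?case
  proof (cases "x \<le> \<beta> * p")
    case True
    then show ?thesis using Suc.prems by (intro exI[of _ 0]) simp
  next
    case False
    then have "\<beta> * (\<beta> * p) \<le> \<beta> * x" using gt_1 by simp
    then have "p \<le> \<beta> * x - 1" using p_eq' by simp
    moreover have "p + \<beta> * p - (\<beta> * x - 1) = \<beta> * (p + \<beta> * p - x)"
      using p_eq' by (simp add: algebra_simps)
    then have "p \<le> \<beta> ^ r * (p + \<beta> * p - (\<beta> * x - 1))"
      using Suc.prems by (simp add: mult_ac)
    ultimately obtain r' where "r' \<le> r" "switches_after r' (\<beta> * x - 1)"
      using Suc.IH by blast
    then show ?thesis using False by (intro exI[of _ "Suc r'"]) simp
  qed
qed

lemma switches_eventually:
  assumes "0 < x" "x < p + \<beta> * p"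
  shows "\<exists>r. switches_after r x"
proof -
  have large: "\<exists>r. p \<le> \<beta> ^ r * y" if y: "0 < y" for y
  proof -
    obtain r where "p / y < \<beta> ^ r" using real_arch_pow[OF gt_1] by blast
    then show ?thesis using y by (intro exI[of _ r]) (simp add: field_simps)
  qed
  show ?thesis
  proof (cases "x \<le> \<beta> * p")
    case True
    then show ?thesis using large[of x] assms switches_from_left by blast
  next
    case False
    then show ?thesis
      using large[of "p + \<beta> * p - x"] assms switches_from_right[of x] p_le by fastforce
  qed
qed

text \<open>Digit \<open>0\<close> leads into \<open>[\<beta> p, 1 + p]\<close> and digit \<open>1\<close> into \<open>[\<beta> p - 1, p]\<close>; in both cases the
  distance to the nearer end of \<open>[0, 1/(\<beta>-1)]\<close> is at least \<open>\<beta> p - 1\<close>.\<close>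

lemma switches_again:
  assumes return: "1 \<le> \<beta> ^ k * (1 + \<beta> - \<beta>\<^sup>2)" and s: "p \<le> fst s" "fst s \<le> \<beta> * p"
  shows "\<exists>r\<le>k. switches_after r (fst (step s))"
proof -
  have margin: "p \<le> \<beta> ^ k * y" if "\<beta> * p - 1 \<le> y" for y
  proof -
    have "p \<le> (\<beta> ^ k * (1 + \<beta> - \<beta>\<^sup>2)) * p"
      using mult_right_mono[OF return, of p] p_pos by simp
    also have "\<dots> = \<beta> ^ k * (\<beta> * p - 1)"
      by (simp only: escape_margin mult.assoc)
    also have "\<dots> \<le> \<beta> ^ k * y"
      using that gt_1 by (intro mult_left_mono) auto
    finally show ?thesis .
  qed
  have lo: "\<beta> * p \<le> \<beta> * fst s" and hi: "\<beta> * fst s \<le> 1 + p"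
    using s gt_1 p_eq' mult_left_mono[OF s(2), of \<beta>] by auto
  show ?thesis
  proof (cases "digit s = 0")
    case True
    then show ?thesis
      using lo hi p_le by (auto simp: fst_step intro!: switches_from_right margin)
  next
    case False
    then have "digit s = 1" using digit_range[of s] by simp
    then show ?thesis
      using lo hi p_le by (auto simp: fst_step intro!: switches_from_left margin)
  qed
qed

text \<open>The remainder after \<open>n\<close> digits is \<open>\<beta>\<^sup>-\<^sup>n\<close> times the \<open>n\<close>-th point of the orbit, and the orbit
  is bounded.\<close>

lemma digit_seq_is_expansion:
  assumes "0 \<le> x" "x \<le> 1 / (\<beta> - 1)"
  shows "digit_seq (x, t) \<in> beta_expansions \<beta> x"
proof -
  define y where "y n = fst ((step ^^ n) (x, t))" for n
  have y_range: "0 \<le> y n \<and> y n \<le> p + \<beta> * p" for n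
  proof (induction n)
    case 0
    then show ?case using assms unfolding y_def right_end by simp
  next
    case (Suc n)
    then show ?case using fst_step_range[of "(step ^^ n) (x, t)"] by (simp add: y_def)
  qed
  have y_Suc: "y (Suc n) = \<beta> * y n - real (digit_seq (x, t) (Suc n))" for n
    by (simp add: y_def fst_step digit_seq_def)
  have partial: "(\<Sum>i<n. real (digit_seq (x, t) (Suc i)) / \<beta> ^ Suc i) = x - y n / \<beta> ^ n" for n
  proof (induction n)
    case 0
    then show ?case by (simp add: y_def)
  next
    case (Suc n)
    have "(y n - y (Suc n) / \<beta>) / \<beta> ^ n = real (digit_seq (x, t) (Suc n)) / \<beta> ^ Suc n"
      using gt_1 by (simp add: y_Suc diff_divide_distrib)
    then have "real (digit_seq (x, t) (Suc n)) / \<beta> ^ Suc n = y n / \<beta> ^ n - y (Suc n) / \<beta> ^ Suc n"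
      by (simp add: diff_divide_distrib)
    then show ?case using Suc by simp
  qed
  have "(\<lambda>n. (p + \<beta> * p) * inverse (\<beta> ^ n)) \<longlonglongrightarrow> (p + \<beta> * p) * 0"
    by (intro tendsto_mult tendsto_const LIMSEQ_inverse_realpow_zero gt_1)
  then have bound_null: "(\<lambda>n. (p + \<beta> * p) * inverse (\<beta> ^ n)) \<longlonglongrightarrow> 0"
    by (simp only: mult_zero_right)
  have bound: "norm (y n / \<beta> ^ n) \<le> (p + \<beta> * p) * inverse (\<beta> ^ n)" for n
  proof -
    have "norm (y n / \<beta> ^ n) = y n * inverse (\<beta> ^ n)"
      using y_range[of n] gt_1 by (simp only: real_norm_def divide_inverse abs_mult) simp
    also have "\<dots> \<le> (p + \<beta> * p) * inverse (\<beta> ^ n)"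
      using y_range[of n] gt_1 by (intro mult_right_mono) auto
    finally show ?thesis .
  qed
  have "(\<lambda>n. y n / \<beta> ^ n) \<longlonglongrightarrow> 0"
    by (rule Lim_null_comparison[OF always_eventually bound_null]) (simp only: bound simp_thms)
  then have "(\<lambda>n. x - y n / \<beta> ^ n) \<longlonglongrightarrow> x - 0"
    by (intro tendsto_diff tendsto_const)
  then have "(\<lambda>n. real (digit_seq (x, t) (Suc n)) / \<beta> ^ Suc n) sums x"
    unfolding sums_def partial by simp
  moreover have "digit_seq (x, t) \<in> digit_seqs"
    using digit_range by (auto simp: digit_seqs_def digit_seq_def PiE_def)
  ultimately show ?thesis
    by (simp add: beta_expansions_def)
qed

text \<open>
  The first \<open>r\<close> digits carry no information on \<open>t\<close>, and after that every block of \<open>k + 1\<close> digits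
  contains a bit of \<open>t\<close>. Equal digits keep the two orbits equal, so that the bits are always read
  at the same times; each common bit halves the distance.
\<close>

lemma common_digits_imp_close:
  assumes return: "1 \<le> \<beta> ^ k * (1 + \<beta> - \<beta>\<^sup>2)"
    and "switches_after r x" "t \<in> {0..<1}" "u \<in> {0..<1}" "r + Suc k * j \<le> n"
    and "\<forall>i<n. digit ((step ^^ i) (x, t)) = digit ((step ^^ i) (x, u))"
  shows "\<bar>t - u\<bar> \<le> (1 / 2) ^ j"
  using assms(2-)
proof (induction n arbitrary: r x t u j)
  case 0
  then show ?case by auto
next
  case (Suc n)
  show ?case
  proof (cases j)
    case 0
    then show ?thesis using Suc.prems by auto
  next
    case (Suc j')
    obtain x1 t1 where st: "step (x, t) = (x1, t1)" by fastforce
    obtain x2 u1 where su: "step (x, u) = (x2, u1)" by fastforce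
    have dig: "digit (x, t) = digit (x, u)"
      using Suc.prems(5) by (metis eq_id_iff funpow_0 zero_less_Suc)
    have "x1 = x2" using st su dig fst_step by (metis fst_conv)
    have tail: "\<forall>i<n. digit ((step ^^ i) (x1, t1)) = digit ((step ^^ i) (x1, u1))"
    proof (intro allI impI)
      fix i assume "i < n"
      then have "digit ((step ^^ Suc i) (x, t)) = digit ((step ^^ Suc i) (x, u))"
        using Suc.prems(5) by blast
      then show "digit ((step ^^ i) (x1, t1)) = digit ((step ^^ i) (x1, u1))"
        using \<open>x1 = x2\<close> by (simp add: st su funpow_Suc_right del: funpow.simps)
    qed
    show ?thesis
    proof (cases r)
      case 0
      then have x: "p \<le> x" "x \<le> \<beta> * p" using Suc.prems by auto
      obtain r' where r': "r' \<le> k" "switches_after r' x1"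
        using switches_again[OF return, of "(x, t)"] x st by auto
      have bits: "t1 = 2 * t - real (digit (x, t))" "u1 = 2 * u - real (digit (x, t))"
        using st su x dig by (auto simp: step_def)
      have "t1 \<in> {0..<1}" "u1 \<in> {0..<1}"
        using bits x dig Suc.prems(2,3) by (auto simp: digit_def split: if_splits)
      moreover have "r' + Suc k * j' \<le> n"
        using Suc.prems(4) r' \<open>j = Suc j'\<close> by simp
      ultimately have "\<bar>t1 - u1\<bar> \<le> (1 / 2) ^ j'"
        using Suc.IH r' tail by blast
      moreover have "t1 - u1 = 2 * (t - u)"
        unfolding bits by simp
      then have "\<bar>t1 - u1\<bar> = 2 * \<bar>t - u\<bar>"
        by (simp only: abs_mult abs_numeral)
      ultimately show ?thesis using \<open>j = Suc j'\<close> by simp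
    next
      case (Suc r')
      then have "t1 = t" "u1 = u" "switches_after r' x1"
        using Suc.prems(1) st su p_le by (auto simp: step_def digit_def)
      moreover have "r' + Suc k * j \<le> n" using Suc.prems(4) Suc by simp
      ultimately show ?thesis using Suc.IH Suc.prems(2,3) tail by blast
    qed
  qed
qed

theorem hausdorff_dim_beta_expansions_ge:
  assumes return: "1 \<le> \<beta> ^ k * (1 + \<beta> - \<beta>\<^sup>2)" and x: "0 < x" "x < 1 / (\<beta> - 1)"
  shows "ennreal (1 / real (Suc k)) \<le> digit_seqs.hausdorff_dim (beta_expansions \<beta> x)"
proof -
  obtain r where r: "switches_after r x"
    using switches_eventually x right_end by auto
  have agree: "\<forall>i<n. digit ((step ^^ i) (x, t)) = digit ((step ^^ i) (x, u))"
    if "\<And>i. 1 \<le> i \<Longrightarrow> i \<le> n \<Longrightarrow> digit_seq (x, t) i = digit_seq (x, u) i" for t u n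
  proof (intro allI impI)
    fix i assume "i < n"
    then show "digit ((step ^^ i) (x, t)) = digit ((step ^^ i) (x, u))"
      using that[of "Suc i"] by (simp add: digit_seq_def)
  qed
  show ?thesis
  proof (rule digit_seqs.hausdorff_dim_ge_if_inverse_Hoelder)
    \<comment> \<open>The factor \<open>2\<^sup>r\<close> pays for the \<open>r\<close> digits before the first choice, and a factor \<open>2\<close> for
      rounding down to complete blocks of \<open>k + 1\<close> digits.\<close>
    show "(0::real) < 2 ^ (r + 1)" by simp
    show "(\<lambda>t. digit_seq (x, t)) ` {0..<1} \<subseteq> beta_expansions \<beta> x"
      using digit_seq_is_expansion x by auto
    fix t u :: real
    assume tu: "t \<in> {0..<1}" "u \<in> {0..<1}" "t \<noteq> u"
    have "digit_seq (x, t) \<noteq> digit_seq (x, u)"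
    proof
      assume same: "digit_seq (x, t) = digit_seq (x, u)"
      have "\<bar>t - u\<bar> \<le> (1 / 2) ^ j" for j
        using common_digits_imp_close[OF return r tu(1,2) order_refl] agree same by metis
      moreover obtain j where "(1 / 2) ^ j < \<bar>t - u\<bar>"
        using real_arch_pow_inv[of "\<bar>t - u\<bar>" "1 / 2"] tu(3) by auto
      ultimately show False by (meson not_le)
    qed
    moreover define N where "N = first_diff (digit_seq (x, t)) (digit_seq (x, u))"
    ultimately have dist: "seq_dist (digit_seq (x, t)) (digit_seq (x, u)) = (1 / 2) ^ N"
      by (simp add: seq_dist_def)
    define j where "j = (N - 1 - r) div Suc k"
    have before: "digit_seq (x, t) i = digit_seq (x, u) i" if "1 \<le> i" "i \<le> N - 1" for i
    proof -
      have "i < first_diff (digit_seq (x, t)) (digit_seq (x, u))"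
        using that unfolding N_def by linarith
      from not_less_Least[OF this[unfolded first_diff_def]] show ?thesis
        using that by blast
    qed
    have "\<bar>t - u\<bar> \<le> (1 / 2) ^ j"
    proof (cases "r \<le> N - 1")
      case True
      have "Suc k * j \<le> N - 1 - r"
        unfolding j_def by (rule times_div_less_eq_dividend)
      then have "r + Suc k * j \<le> N - 1" using True by linarith
      then show ?thesis
        using common_digits_imp_close[OF return r tu(1,2)] agree before by blast
    next
      case False
      then have "j = 0" by (simp add: j_def)
      then show ?thesis using tu by auto
    qed
    also have "\<dots> = 2 powr - real j"
      by (simp add: powr_minus powr_realpow power_one_over inverse_eq_divide)
    also have "\<dots> \<le> 2 powr (real (r + 1) - real N / real (Suc k))"
    proof -
      have "N - 1 - r < Suc k * j + Suc k"
        unfolding j_def by (metis dividend_less_times_div zero_less_Suc add.commute)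
      then have "N \<le> r + Suc k * (j + 1)" by simp
      also have "\<dots> \<le> Suc k * r + Suc k * (j + 1)" by simp
      also have "\<dots> = Suc k * (r + j + 1)" by (simp only: distrib_left add.assoc)
      finally have "real N \<le> real (Suc k) * real (r + j + 1)"
        unfolding of_nat_mult[symmetric] of_nat_le_iff .
      then have "real N / real (Suc k) \<le> real (r + j + 1)"
        by (simp add: pos_divide_le_eq mult.commute del: of_nat_Suc)
      then show ?thesis by (intro powr_mono) auto
    qed
    also have "\<dots> = 2 ^ (r + 1) * ((1 / 2) ^ N) powr (1 / real (Suc k))"
    proof -
      have "(1 / 2 :: real) ^ N = 2 powr - real N"
        by (simp add: powr_minus powr_realpow power_one_over inverse_eq_divide)
      then have "((1 / 2 :: real) ^ N) powr (1 / real (Suc k)) = 2 powr (- (real N / real (Suc k)))"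
        by (simp add: powr_powr)
      moreover have "(2::real) ^ (r + 1) = 2 powr real (r + 1)"
        by (rule powr_realpow[symmetric]) simp
      ultimately show ?thesis
        by (simp only: powr_add[symmetric] diff_conv_add_uminus)
    qed
    finally show "\<bar>t - u\<bar> \<le> 2 ^ (r + 1) *
        seq_dist (digit_seq (x, t)) (digit_seq (x, u)) powr (1 / real (Suc k))"
      by (simp only: dist)
  qed
qed

end

section \<open>Thresholds converging to the golden ratio\<close>

text \<open>The positive root of \<open>X\<^sup>2 = c X + 1\<close>; the golden ratio is \<open>threshold 1\<close>.\<close>

definition threshold :: "real \<Rightarrow> real" where
  "threshold c = (c + sqrt (c\<^sup>2 + 4)) / 2"

lemma threshold_strict_mono:
  assumes "0 \<le> c" "c < c'"
  shows "threshold c < threshold c'"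
proof -
  have "c\<^sup>2 < c'\<^sup>2" using assms by (intro power_strict_mono) auto
  then show ?thesis using assms by (simp add: threshold_def add_strict_mono)
qed

lemma square_le_if_le_threshold:
  assumes "0 < b" "b \<le> threshold c"
  shows "b\<^sup>2 \<le> c * b + 1"
proof -
  define w where "w = sqrt (c\<^sup>2 + 4)"
  have w: "w\<^sup>2 = c\<^sup>2 + 4" by (simp add: w_def)
  have "\<bar>c\<bar> \<le> w" unfolding w_def by (rule real_le_rsqrt) simp
  then have "0 \<le> (b - (c - w) / 2) * ((c + w) / 2 - b)"
    using assms unfolding threshold_def w_def[symmetric]
    by (intro mult_nonneg_nonneg) auto
  also have "\<dots> = c * b - b\<^sup>2 + (w\<^sup>2 - c\<^sup>2) / 4"
    by (simp add: field_simps power2_eq_square)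
  finally show ?thesis using w by simp
qed

text \<open>After Bernoulli's inequality \<open>b\<^sup>k \<ge> 1 + k (b - 1)\<close> what remains is exact: the product of this
  lower bound with \<open>1 + b - b\<^sup>2\<close> exceeds \<open>1\<close> by \<open>(b - 1) (k (1 + b - b\<^sup>2) - b)\<close>.\<close>

lemma return_condition:
  fixes b :: real
  assumes "1 < b" and le: "b\<^sup>2 \<le> (1 - 1 / real k) * b + 1" and "0 < k"
  shows "1 \<le> b ^ k * (1 + b - b\<^sup>2)"
proof -
  have y: "b \<le> real k * (1 + b - b\<^sup>2)"
    using le \<open>0 < k\<close> by (simp add: field_simps)
  then have "0 \<le> 1 + b - b\<^sup>2"
    using zero_less_mult_pos[of "real k" "1 + b - b\<^sup>2"] assms by linarith
  have "0 \<le> (b - 1) * (real k * (1 + b - b\<^sup>2) - b)"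
    using y \<open>1 < b\<close> by simp
  then have "1 \<le> (1 + real k * (b - 1)) * (1 + b - b\<^sup>2)"
    by (simp add: algebra_simps power2_eq_square)
  also have "\<dots> \<le> b ^ k * (1 + b - b\<^sup>2)"
    using Bernoulli_inequality[of "b - 1" k] \<open>1 < b\<close> \<open>0 \<le> 1 + b - b\<^sup>2\<close>
    by (intro mult_right_mono) auto
  finally show ?thesis .
qed

theorem theorem1p4:
  shows "\<exists>l :: nat \<Rightarrow> real.
    strict_mono_on {1..} l \<and> l \<longlonglongrightarrow> (1 + sqrt 5) / 2 \<and>
    (\<forall>m\<ge>1. \<forall>\<beta>::real. 1 < \<beta> \<and> \<beta> \<le> l m \<longrightarrow>
      (\<forall>x::real. 0 < x \<and> x < 1 / (\<beta> - 1) \<longrightarrow>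
        ennreal (1 / (real m + 2)) \<le> digit_seqs.hausdorff_dim (beta_expansions \<beta> x)))"
proof -
  define l where "l m = threshold (1 - 1 / real (Suc m))" for m
  have "strict_mono_on {1..} l"
  proof (rule strict_mono_onI)
    fix m n :: nat
    assume "m < n"
    then have "1 / real (Suc n) < 1 / real (Suc m)"
      by (intro divide_strict_left_mono) auto
    then show "l m < l n"
      unfolding l_def by (intro threshold_strict_mono) auto
  qed
  moreover have "l \<longlonglongrightarrow> (1 + sqrt 5) / 2"
  proof -
    have "(\<lambda>m. 1 - 1 / real (Suc m)) \<longlonglongrightarrow> 1 - 0"
      using LIMSEQ_inverse_real_of_nat
      by (intro tendsto_diff tendsto_const) (simp add: inverse_eq_divide)
    moreover have "isCont threshold (1 - 0)"
      unfolding threshold_def by (intro continuous_intros) auto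
    ultimately have "l \<longlonglongrightarrow> threshold (1 - 0)"
      unfolding l_def by (rule isCont_tendsto_compose[rotated])
    then show ?thesis by (simp add: threshold_def)
  qed
  moreover have "ennreal (1 / (real m + 2)) \<le> digit_seqs.hausdorff_dim (beta_expansions \<beta> x)"
    if "1 < \<beta>" "\<beta> \<le> l m" "0 < x" "x < 1 / (\<beta> - 1)" for m and \<beta> x :: real
  proof -
    have le: "\<beta>\<^sup>2 \<le> (1 - 1 / real (Suc m)) * \<beta> + 1"
      using that square_le_if_le_threshold[of \<beta>] by (simp add: l_def)
    also have "\<dots> < \<beta> + 1"
      using \<open>1 < \<beta>\<close> by (simp add: field_simps)
    finally interpret below_golden_ratio \<beta>
      using \<open>1 < \<beta>\<close> by unfold_locales
    have "1 \<le> \<beta> ^ Suc m * (1 + \<beta> - \<beta>\<^sup>2)"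
      using return_condition[OF \<open>1 < \<beta>\<close> le] by simp
    from hausdorff_dim_beta_expansions_ge[OF this that(3,4)] show ?thesis
      by (simp add: add.commute)
  qed
  ultimately show ?thesis by blast
qed

end
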